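(* Consider a system of $n\ge 2$ oblivious fully synchronous robots without chirality, and let $C_0$ be an initial configuration. Then \textsc{Move-All} is solvable in $1$ step from $C_0$ if and only if $C_0\notin\mathcal C_\odot$ and $C_0$ does not have a symmetry axis containing exactly one robot.
   Context: Model. There are $n\ge 2$ robots $r_0,\dots,r_{n-1}$, which are points in $\mathbb R^2$. A configuration is a tuple $C=(p_0,\dots,p_{n-1})$ of points, $p_i$ being the position of $r_i$ in a fixed global coordinate system unknown to the robots; an initial configuration consists of pairwise distinct points. Each robot $r_i$ has a local Cartesian coordinate system $Z_i$, always centred at its current position, whose orientation and unit length are fixed over time but arbitrary and possibly different for different robots. No chirality: the handedness of the $Z_i$ is also arbitrary and may differ between robots. Robots are anonymous, oblivious and deterministic: an algorithm $\mathcal A$ is one function, the same for all robots, mapping a snapshot (the multiset of positions of all robots expressed in the observing robot's local coordinate system, its own position being the origin) to a destination point (in the same local coordinates). In each round all robots simultaneously take a snapshot, compute their destination, and move exactly to it. Thus $C_0$ and $Z=(Z_0,\dots,Z_{n-1})$ determine the run $(C_0,C_1,C_2,\dots)$ of $\mathcal A$. Permutations. For a permutation $\pi$ of $\{0,\dots,n-1\}$ put $\pi(C)=(p_{\pi(0)},\dots,p_{\pi(n-1)})$. $\Pi_2$ is the set of permutations without fixed points. Problem. $\mathcal A$ solves \textsc{Move-All} in $1$ step from $C_0$ if for every admissible $Z$ the run from $C_0$ satisfies: there is $\pi\in\Pi_2$ with $C_i=\pi^i(C_0)$ for all $i\ge 0$. The problem is solvable in $1$ step from $C_0$ if some algorithm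 does this. $\mathcal C_\odot$ is the set of configurations $C$ having exactly one robot $r_c$ (the central robot) at the centre of the smallest circle enclosing $C$, and such that for some integer $k>1$ the rotation by $2\pi/k$ about the position of $r_c$ maps the multiset of points of $C$ to itself (so $n\ge 3$). A symmetry axis of $C$ is a line such that reflection in it maps the set of points of $C$ to itself. *)

theory Defs
  imports "HOL-Analysis.Analysis" "HOL-Combinatorics.Permutations" "HOL-Library.Multiset"
begin

type_synonym point = "real ^ 2"

text \<open>
  A configuration of \<open>n\<close> robots is a function on indices; only the values at indices
  below \<open>n\<close> are meaningful, and none of the definitions below depends on the others.
\<close>
type_synonym config = "nat \<Rightarrow> point"

definition initial_config :: "nat \<Rightarrow> config \<Rightarrow> bool" where
  "initial_config n C \<longleftrightarrow> inj_on C {..<n}"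

definition points :: "nat \<Rightarrow> config \<Rightarrow> point multiset" where
  "points n C = image_mset C (mset_set {..<n})"


text \<open>
  The time-independent part of a local coordinate system. Its axes are given in global
  coordinates; its origin is always the current position of the robot. No orientation of the
  pair of axes is prescribed, so both handednesses are admissible.
\<close>
record frame =
  unit_length :: real
  x_axis :: point
  y_axis :: point

definition cartesian :: "frame \<Rightarrow> bool" where
  "cartesian z \<longleftrightarrow> unit_length z > 0 \<and> norm (x_axis z) = 1 \<and> norm (y_axis z) = 1 \<and>
     x_axis z \<bullet> y_axis z = 0"

definition to_local :: "frame \<Rightarrow> point \<Rightarrow> point \<Rightarrow> point" where
  "to_local z p q =
     vector [(q - p) \<bullet> x_axis z / unit_length z, (q - p) \<bullet> y_axis z / unit_length z]"

definition to_global :: "frame \<Rightarrow> point \<Rightarrow> point \<Rightarrow> point" where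
  "to_global z p v = p + unit_length z *\<^sub>R (v $ 1 *\<^sub>R x_axis z + v $ 2 *\<^sub>R y_axis z)"

definition admissible :: "nat \<Rightarrow> (nat \<Rightarrow> frame) \<Rightarrow> bool" where
  "admissible n Z \<longleftrightarrow> (\<forall>i<n. cartesian (Z i))"


type_synonym algorithm = "point multiset \<Rightarrow> point"

definition snapshot :: "nat \<Rightarrow> (nat \<Rightarrow> frame) \<Rightarrow> config \<Rightarrow> nat \<Rightarrow> point multiset" where
  "snapshot n Z C i = image_mset (to_local (Z i) (C i)) (points n C)"

definition move :: "nat \<Rightarrow> algorithm \<Rightarrow> (nat \<Rightarrow> frame) \<Rightarrow> config \<Rightarrow> config" where
  "move n A Z C = (\<lambda>i. to_global (Z i) (C i) (A (snapshot n Z C i)))"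

definition run :: "nat \<Rightarrow> algorithm \<Rightarrow> (nat \<Rightarrow> frame) \<Rightarrow> config \<Rightarrow> nat \<Rightarrow> config" where
  "run n A Z C0 t = (move n A Z ^^ t) C0"


definition permute_config :: "(nat \<Rightarrow> nat) \<Rightarrow> config \<Rightarrow> config" where
  "permute_config \<pi> C = (\<lambda>i. C (\<pi> i))"

definition fixpoint_free_perms :: "nat \<Rightarrow> (nat \<Rightarrow> nat) set" where
  "fixpoint_free_perms n = {\<pi>. \<pi> permutes {..<n} \<and> (\<forall>i<n. \<pi> i \<noteq> i)}"

definition solves_move_all_1 :: "nat \<Rightarrow> algorithm \<Rightarrow> config \<Rightarrow> bool" where
  "solves_move_all_1 n A C0 \<longleftrightarrow>
     (\<forall>Z. admissible n Z \<longrightarrow>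
       (\<exists>\<pi>\<in>fixpoint_free_perms n. \<forall>t. \<forall>j<n. run n A Z C0 t j = permute_config (\<pi> ^^ t) C0 j))"

definition move_all_1_solvable :: "nat \<Rightarrow> config \<Rightarrow> bool" where
  "move_all_1_solvable n C0 \<longleftrightarrow> (\<exists>A. solves_move_all_1 n A C0)"


definition smallest_enclosing_circle :: "nat \<Rightarrow> config \<Rightarrow> point \<Rightarrow> real \<Rightarrow> bool" where
  "smallest_enclosing_circle n C c r \<longleftrightarrow>
     C ` {..<n} \<subseteq> cball c r \<and> (\<forall>c' r'. C ` {..<n} \<subseteq> cball c' r' \<longrightarrow> r \<le> r')"

definition rotate_about :: "point \<Rightarrow> real \<Rightarrow> point \<Rightarrow> point" where
  "rotate_about c \<theta> q =
     c + vector [cos \<theta> * (q - c) $ 1 - sin \<theta> * (q - c) $ 2,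
                 sin \<theta> * (q - c) $ 1 + cos \<theta> * (q - c) $ 2]"

definition C_odot :: "nat \<Rightarrow> config set" where
  "C_odot n = {C. \<exists>c r. smallest_enclosing_circle n C c r \<and> (\<exists>!i. i < n \<and> C i = c) \<and>
     (\<exists>k::nat. k > 1 \<and> image_mset (rotate_about c (2 * pi / real k)) (points n C) = points n C)}"


definition line :: "point set \<Rightarrow> bool" where
  "line L \<longleftrightarrow> affine L \<and> aff_dim L = 1"

text \<open>The closest point of a line is the foot of the perpendicular.\<close>
definition reflect_in :: "point set \<Rightarrow> point \<Rightarrow> point" where
  "reflect_in L q = 2 *\<^sub>R closest_point L q - q"

definition symmetry_axis :: "nat \<Rightarrow> config \<Rightarrow> point set \<Rightarrow> bool" where
  "symmetry_axis n C L \<longleftrightarrow> line L \<and> reflect_in L ` (C ` {..<n}) = C ` {..<n}"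

end

theory Submission
  imports Defs
begin

text \<open>
  A symmetry \<open>g\<close> of the configuration fixing exactly one robot \<open>r\<close> defeats every algorithm: if some
  robot moves onto \<open>r\<close>, its image under \<open>g\<close> moves there too once it is given the image of its frame.
  Conversely, solving the problem amounts to finding a fixed-point-free permutation of the points
  that commutes with all similarities preserving them, and these all fix the centroid. The point
  reflection in the centroid will do if it is a symmetry. Otherwise only reflections of the plane
  have fixed robots; a symmetry mapping a robot on an axis to a robot on the same axis is then the
  identity or the reflection in that axis. So one may permute the robots of one axis cyclically and
  transport this permutation to the other axes of its orbit, while robots off the axes are moved
  within their free orbits. The degenerate case of a trivial symmetry group is a cyclic permutation
  of all robots.
\<close>

section \<open>Equivariant derangements\<close>

text \<open>Shift cyclically along an enumeration: the successor modulo \<open>m\<close> fixes no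
  index as soon as \<open>m > 1\<close>, and for the empty set there is nothing to check.\<close>

lemma fixpoint_free_surjection_exists:
  fixes B :: "'a set"
  assumes "finite B" "card B \<noteq> 1"
  shows "\<exists>s. s ` B = B \<and> (\<forall>b\<in>B. s b \<noteq> b)"
proof -
  define m where "m = card B"
  obtain e where e: "bij_betw e {..<m} B"
    using assms(1) ex_bij_betw_nat_finite m_def by (metis atLeast0LessThan)
  define k where "k = the_inv_into {..<m} e"
  have k: "k (e i) = i" if "i < m" for i
    using e that by (simp add: bij_betw_def k_def the_inv_into_f_f)
  have B: "B = e ` {..<m}" using e by (simp add: bij_betw_def)
  define s where "s = (\<lambda>b. e (Suc (k b) mod m))"
  have ne: "s b \<noteq> b" if b: "b \<in> B" for b
  proof -
    obtain i where i: "i < m" "b = e i" using b B by blast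
    have m: "m > 1" using assms(2) i by (simp add: m_def)
    have "Suc i mod m \<noteq> i" using i m by (auto simp: mod_Suc)
    moreover have "Suc i mod m < m" using m by simp
    ultimately show ?thesis using k i by (metis s_def)
  qed
  have sub: "B \<subseteq> s ` B"
  proof
    fix b assume "b \<in> B"
    then obtain i where i: "i < m" "b = e i" using B by blast
    \<comment> \<open>The cyclic predecessor of \<open>i\<close>; index 0 wraps around to
      \<open>m - 1\<close>.\<close>
    define j where "j = (if i = 0 then m - 1 else i - 1)"
    have j: "j < m" "Suc j mod m = i" using i by (auto simp: j_def)
    then have "s (e j) = b" using i k by (simp add: s_def)
    then show "b \<in> s ` B" using j(1) B by blast
  qed
  have "s ` B \<subseteq> B"
  proof
    fix b assume "b \<in> s ` B"
    then obtain i where "i < m" "b = s (e i)" using B by blast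
    then show "b \<in> B" using k by (subst B) (auto simp: s_def)
  qed
  then show ?thesis using sub ne by blast
qed

text \<open>
  The equivariant map sends \<open>g b\<close> to \<open>g (s b)\<close>, where the block \<open>B\<close> is a transversal.
\<close>
lemma equivariant_extension:
  fixes G :: "('a \<Rightarrow> 'a) set"
  assumes comp: "\<And>g h. g \<in> G \<Longrightarrow> h \<in> G \<Longrightarrow> g \<circ> h \<in> G"
    and inv: "\<And>g. g \<in> G \<Longrightarrow> \<exists>h\<in>G. h \<circ> g = id \<and> g \<circ> h = id"
    and block: "\<And>g b b'. g \<in> G \<Longrightarrow> b \<in> B \<Longrightarrow> b' \<in> B \<Longrightarrow> g b = b' \<Longrightarrow> b = b' \<and> g (s b) = s b"
    and free: "\<And>b. b \<in> B \<Longrightarrow> s b \<noteq> b"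
    and into: "\<And>b. b \<in> B \<Longrightarrow> \<exists>g\<in>G. \<exists>b'\<in>B. s b = g b'"
    and onto: "\<And>b. b \<in> B \<Longrightarrow> \<exists>g\<in>G. \<exists>b'\<in>B. b = g (s b')"
  defines "Q \<equiv> {g b | g b. g \<in> G \<and> b \<in> B}"
  shows "\<exists>f. f ` Q = Q \<and> (\<forall>q\<in>Q. f q \<noteq> q) \<and> (\<forall>g\<in>G. \<forall>q\<in>Q. f (g q) = g (f q))"
proof -
  define f where "f = (\<lambda>q. SOME r. \<exists>g\<in>G. \<exists>b\<in>B. q = g b \<and> r = g (s b))"
  have f: "f (g b) = g (s b)" if "g \<in> G" "b \<in> B" for g b
  proof -
    have "\<exists>h\<in>G. \<exists>c\<in>B. g b = h c \<and> f (g b) = h (s c)"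
      unfolding f_def by (rule someI_ex) (use that in blast)
    then obtain h c where h: "h \<in> G" "c \<in> B" "g b = h c" "f (g b) = h (s c)" by blast
    \<comment> \<open>Well-definedness: if one point is written both as \<open>g b\<close> and as
      \<open>h c\<close>, then \<open>k \<circ> g\<close> maps block to block, so
      \<open>block\<close> gives \<open>b = c\<close> and shows that both representations yield the
      same value.\<close>
    obtain k where k: "k \<in> G" "k \<circ> h = id" "h \<circ> k = id" using inv h(1) by blast
    have "(k \<circ> g) b = c" using h(3) k(2) by (metis comp_apply id_apply)
    then have "b = c" "(k \<circ> g) (s b) = s b"
      using block[OF comp[OF k(1) that(1)] that(2) h(2)] by auto
    then show ?thesis using h(4) k(3) by (metis comp_apply id_apply)
  qed
  have fQ: "f q \<in> Q" if q: "q \<in> Q" for q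
  proof -
    obtain g b where g: "g \<in> G" "b \<in> B" "q = g b" using q unfolding Q_def by blast
    obtain h c where h: "h \<in> G" "c \<in> B" "s b = h c" using into g(2) by blast
    have "f q = (g \<circ> h) c" using f g h by simp
    then show ?thesis using comp[OF g(1) h(1)] h(2) Q_def by blast
  qed
  have Qf: "q \<in> f ` Q" if q: "q \<in> Q" for q
  proof -
    obtain g b where g: "g \<in> G" "b \<in> B" "q = g b" using q unfolding Q_def by blast
    obtain h c where h: "h \<in> G" "c \<in> B" "b = h (s c)" using onto g(2) by blast
    have "q = f ((g \<circ> h) c)" using f[OF comp[OF g(1) h(1)] h(2)] g h by simp
    moreover have "(g \<circ> h) c \<in> Q" using comp[OF g(1) h(1)] h(2) Q_def by blast
    ultimately show ?thesis by blast
  qed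
  have ne: "f q \<noteq> q" if q: "q \<in> Q" for q
  proof
    assume *: "f q = q"
    obtain g b where g: "g \<in> G" "b \<in> B" "q = g b" using q unfolding Q_def by blast
    obtain k where "k \<circ> g = id" using inv g(1) by blast
    then have "s b = b" using * f g by (metis comp_apply id_apply)
    then show False using free g(2) by blast
  qed
  have eq: "f (g q) = g (f q)" if g: "g \<in> G" and q: "q \<in> Q" for g q
  proof -
    obtain h b where h: "h \<in> G" "b \<in> B" "q = h b" using q unfolding Q_def by blast
    then show ?thesis using f[OF comp[OF g h(1)] h(2)] f[OF h(1,2)] by simp
  qed
  show ?thesis using fQ Qf ne eq by blast
qed

text \<open>Induction on the size of \<open>P\<close>, splitting off one invariant set swept out by
  a block. If some \<sigma> other than the identity fixes \<open>p\<close>, the block is the fixed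
  set of \<sigma>, permuted cyclically; otherwise the orbit of \<open>p\<close> is free and
  \<open>p\<close> may be sent to \<open>g0 p\<close>. By the hypothesis on pairs \<open>g\<close>,
  \<sigma>, an element that returns a block point to the block acts trivially on the whole
  block.\<close>

lemma equivariant_derangement_nontrivial:
  fixes G :: "('a \<Rightarrow> 'a) set"
  assumes id: "id \<in> G"
    and comp: "\<And>g h. g \<in> G \<Longrightarrow> h \<in> G \<Longrightarrow> g \<circ> h \<in> G"
    and inv: "\<And>g. g \<in> G \<Longrightarrow> \<exists>h\<in>G. h \<circ> g = id \<and> g \<circ> h = id"
    and nontrivial: "g0 \<in> G" "g0 \<noteq> id"
    and "finite P"
    and "\<And>g p. g \<in> G \<Longrightarrow> p \<in> P \<Longrightarrow> g p \<in> P"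
    and "\<And>g \<sigma> b. g \<in> G \<Longrightarrow> \<sigma> \<in> G \<Longrightarrow> \<sigma> \<noteq> id \<Longrightarrow> b \<in> P \<Longrightarrow> \<sigma> b = b \<Longrightarrow> \<sigma> (g b) = g b \<Longrightarrow>
      g = id \<or> g = \<sigma>"
    and "\<And>\<sigma>. \<sigma> \<in> G \<Longrightarrow> \<sigma> \<noteq> id \<Longrightarrow> card {p \<in> P. \<sigma> p = p} \<noteq> 1"
  shows "\<exists>f. f ` P = P \<and> (\<forall>p\<in>P. f p \<noteq> p) \<and> (\<forall>g\<in>G. \<forall>p\<in>P. f (g p) = g (f p))"
  using assms(6-)
proof (induction "card P" arbitrary: P rule: less_induct)
  case less
  note fin = less.prems(1) and P = less.prems(2) and K = less.prems(3) and N = less.prems(4)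
  show ?case
  proof (cases "P = {}")
    case False
    then obtain p where p: "p \<in> P" by blast
    \<comment> \<open>These are the conditions of \<open>equivariant_extension\<close>, followed by
      a closure condition: an element other than the identity that fixes one block point has all its
      fixed points in the block. The latter keeps the fixed-point count intact when the swept-out
      set is removed.\<close>
    define blk where "blk = (\<lambda>B s. B \<subseteq> P \<and> p \<in> B \<and>
      (\<forall>g\<in>G. \<forall>b\<in>B. g b \<in> B \<longrightarrow> g b = b \<and> g (s b) = s b) \<and>
      (\<forall>b\<in>B. s b \<noteq> b) \<and> (\<forall>b\<in>B. \<exists>g\<in>G. \<exists>b'\<in>B. s b = g b') \<and>
      (\<forall>b\<in>B. \<exists>g\<in>G. \<exists>b'\<in>B. b = g (s b')) \<and>
      (\<forall>\<tau>\<in>G. \<tau> \<noteq> id \<longrightarrow> (\<exists>b\<in>B. \<tau> b = b) \<longrightarrow> {q\<in>P. \<tau> q = q} \<subseteq> B))"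
    have "\<exists>B s. blk B s"
    proof (cases "\<exists>\<sigma>\<in>G. \<sigma> \<noteq> id \<and> \<sigma> p = p")
      case True
      then obtain \<sigma> where \<sigma>: "\<sigma> \<in> G" "\<sigma> \<noteq> id" "\<sigma> p = p" by blast
      define B where "B = {q\<in>P. \<sigma> q = q}"
      \<comment> \<open>\<open>B\<close> contains \<open>p\<close> and, by \<open>N\<close>, is not
        a singleton, so the cyclic shift is available.\<close>
      obtain s where s: "s ` B = B" "\<forall>b\<in>B. s b \<noteq> b"
        using fixpoint_free_surjection_exists[of B] N[OF \<sigma>(1,2)] fin unfolding B_def by auto
      have triv: "g = id \<or> g = \<sigma>" if "g \<in> G" "b \<in> B" "g b \<in> B" for g b
        using K[OF that(1) \<sigma>(1,2)] that(2,3) B_def by auto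
      have "blk B s"
        unfolding blk_def
      proof (intro conjI allI impI ballI)
        show "B \<subseteq> P" "p \<in> B" using p \<sigma> by (auto simp: B_def)
        fix g b assume g: "g \<in> G" "b \<in> B" "g b \<in> B"
        have "g = id \<or> g = \<sigma>" using triv g by blast
        moreover have "s b \<in> B" using s(1) g(2) by blast
        ultimately show "g b = b" "g (s b) = s b" using g B_def by auto
      next
        fix b assume b: "b \<in> B"
        show "s b \<noteq> b" using s b by blast
        have "s b \<in> B" using s(1) b by blast
        then show "\<exists>g\<in>G. \<exists>b'\<in>B. s b = g b'" using id by (metis id_apply)
        have "\<exists>b'\<in>B. b = s b'" using s(1) b by blast
        then show "\<exists>g\<in>G. \<exists>b'\<in>B. b = g (s b')" using id by (metis id_apply)
      next
        fix \<tau> assume \<tau>: "\<tau> \<in> G" "\<tau> \<noteq> id" "\<exists>b\<in>B. \<tau> b = b"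
        then have "\<tau> = \<sigma>" using triv by metis
        then show "{q\<in>P. \<tau> q = q} \<subseteq> B" by (simp add: B_def)
      qed
      then show ?thesis by blast
    next
      case False
      then have st: "g = id" if "g \<in> G" "g p = p" for g using that by blast
      \<comment> \<open>With a trivial stabiliser a single point is a block, and \<open>g0 p\<close>
        differs from \<open>p\<close> because \<open>g0\<close> is not the identity.\<close>
      have "blk {p} (\<lambda>_. g0 p)"
      proof -
        obtain h where h: "h \<in> G" "h \<circ> g0 = id" using inv nontrivial by blast
        have "p = h (g0 p)" using h(2) by (metis comp_apply id_apply)
        moreover have "g (g0 p) = g0 p" if "g \<in> G" "g p = p" for g using st[OF that] by simp
        ultimately show ?thesis unfolding blk_def using st p nontrivial h(1) by auto
      qed
      then show ?thesis by blast
    qed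
    then obtain B s where bs: "blk B s" by blast
    have BP: "B \<subseteq> P" and pB: "p \<in> B" using bs by (simp_all add: blk_def)
    have block: "b = b' \<and> g (s b) = s b" if "g \<in> G" "b \<in> B" "b' \<in> B" "g b = b'" for g b b'
    proof -
      have "g b \<in> B" using that by simp
      then have "g b = b \<and> g (s b) = s b" using bs that(1,2) by (simp add: blk_def)
      then show ?thesis using that(4) by simp
    qed
    have free: "s b \<noteq> b" if "b \<in> B" for b using bs that by (simp add: blk_def)
    have into: "\<exists>g\<in>G. \<exists>b'\<in>B. s b = g b'" if "b \<in> B" for b using bs that by (simp add: blk_def)
    have onto: "\<exists>g\<in>G. \<exists>b'\<in>B. b = g (s b')" if "b \<in> B" for b using bs that by (simp add: blk_def)
    have fixB: "{q\<in>P. \<tau> q = q} \<subseteq> B" if "\<tau> \<in> G" "\<tau> \<noteq> id" "b \<in> B" "\<tau> b = b" for \<tau> b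
    proof -
      have "\<forall>\<tau>\<in>G. \<tau> \<noteq> id \<longrightarrow> (\<exists>b\<in>B. \<tau> b = b) \<longrightarrow> {q\<in>P. \<tau> q = q} \<subseteq> B"
        using bs unfolding blk_def by (elim conjE)
      then show ?thesis using that by blast
    qed
    define Q where "Q = {g b | g b. g \<in> G \<and> b \<in> B}"
    have "\<exists>f. f ` Q = Q \<and> (\<forall>q\<in>Q. f q \<noteq> q) \<and> (\<forall>g\<in>G. \<forall>q\<in>Q. f (g q) = g (f q))"
      unfolding Q_def
    proof (rule equivariant_extension[where s = s])
      show "g \<circ> h \<in> G" if "g \<in> G" "h \<in> G" for g h using comp[OF that] .
      show "\<exists>h\<in>G. h \<circ> g = id \<and> g \<circ> h = id" if "g \<in> G" for g using inv[OF that] .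
      show "b = b' \<and> g (s b) = s b" if "g \<in> G" "b \<in> B" "b' \<in> B" "g b = b'" for g b b'
        using block[OF that] .
      show "s b \<noteq> b" if "b \<in> B" for b using free[OF that] .
      show "\<exists>g\<in>G. \<exists>b'\<in>B. s b = g b'" if "b \<in> B" for b using into[OF that] .
      show "\<exists>g\<in>G. \<exists>b'\<in>B. b = g (s b')" if "b \<in> B" for b using onto[OF that] .
    qed
    then obtain f1 where f1: "f1 ` Q = Q" "\<forall>q\<in>Q. f1 q \<noteq> q" "\<forall>g\<in>G. \<forall>q\<in>Q. f1 (g q) = g (f1 q)"
      by blast
    have QP: "Q \<subseteq> P" using BP P unfolding Q_def by blast
    have pQ: "p \<in> Q" using pB id unfolding Q_def by (metis (mono_tags, lifting) id_apply mem_Collect_eq)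
    have gQ: "g q \<in> Q" if g: "g \<in> G" and q: "q \<in> Q" for g q
    proof -
      obtain h b where h: "h \<in> G" "b \<in> B" "q = h b" using q unfolding Q_def by blast
      then have "g q = (g \<circ> h) b" by simp
      then show ?thesis unfolding Q_def using comp[OF g h(1)] h(2) by blast
    qed
    have gQ': "q \<in> Q" if g: "g \<in> G" and q: "g q \<in> Q" for g q
    proof -
      obtain h where "h \<in> G" "h \<circ> g = id" using inv g by blast
      then show ?thesis using gQ[of h "g q"] q by (metis comp_apply id_apply)
    qed
    \<comment> \<open>All or nothing: either \<tau> has no fixed point in \<open>Q\<close>, and its
      count is unchanged, or all its fixed points lie in \<open>Q\<close>, and none remain.\<close>
    have N': "card {q \<in> P - Q. \<tau> q = q} \<noteq> 1" if \<tau>: "\<tau> \<in> G" "\<tau> \<noteq> id" for \<tau>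
    proof (cases "\<exists>q\<in>Q. \<tau> q = q")
      case False
      then have "{q \<in> P - Q. \<tau> q = q} = {q \<in> P. \<tau> q = q}" by blast
      then show ?thesis using N[OF \<tau>] by simp
    next
      case True
      then obtain g b where g: "g \<in> G" "b \<in> B" "\<tau> (g b) = g b" unfolding Q_def by blast
      obtain h where h: "h \<in> G" "h \<circ> g = id" "g \<circ> h = id" using inv g(1) by blast
      have hg: "h (g x) = x" "g (h x) = x" for x using h by (metis comp_apply id_apply)+
      \<comment> \<open>Conjugation moves the fixed point \<open>g b\<close> of \<tau> into the
        block. There the closure condition captures all fixed points of the conjugate, and
        \<open>g\<close> carries them back into \<open>Q\<close>.\<close>
      define \<rho> where "\<rho> = h \<circ> (\<tau> \<circ> g)"
      have \<rho>: "\<rho> \<in> G" using comp \<tau> g h by (simp add: \<rho>_def)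
      have "\<rho> \<noteq> id"
      proof
        assume "\<rho> = id"
        then have "\<tau> x = x" for x using hg by (metis \<rho>_def comp_apply id_apply)
        then show False using \<tau>(2) by auto
      qed
      moreover have "\<rho> b = b" using g(3) hg by (simp add: \<rho>_def)
      ultimately have sub: "{q\<in>P. \<rho> q = q} \<subseteq> B" using fixB \<rho> g(2) by blast
      have "q \<in> Q" if "q \<in> P" "\<tau> q = q" for q
      proof -
        have "\<rho> (h q) = h q" using that hg by (simp add: \<rho>_def)
        then have "h q \<in> B" using sub P[OF h(1) that(1)] by blast
        then show ?thesis unfolding Q_def using g(1) hg(2)[of q] by (metis (mono_tags, lifting) mem_Collect_eq)
      qed
      then have "{q \<in> P - Q. \<tau> q = q} = {}" by blast
      then show ?thesis by (simp only: card.empty)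
    qed
    have "card (P - Q) < card P" using pQ p fin by (intro psubset_card_mono) auto
    then have "\<exists>f. f ` (P - Q) = P - Q \<and> (\<forall>p\<in>P - Q. f p \<noteq> p) \<and> (\<forall>g\<in>G. \<forall>p\<in>P - Q. f (g p) = g (f p))"
    proof (rule less.hyps)
      show "finite (P - Q)" using fin by simp
      show "g p \<in> P - Q" if "g \<in> G" "p \<in> P - Q" for g p using that P gQ' by blast
      show "g = id \<or> g = \<sigma>" if "g \<in> G" "\<sigma> \<in> G" "\<sigma> \<noteq> id" "b \<in> P - Q" "\<sigma> b = b" "\<sigma> (g b) = g b"
        for g \<sigma> b using K that by blast
      show "card {p \<in> P - Q. \<sigma> p = p} \<noteq> 1" if "\<sigma> \<in> G" "\<sigma> \<noteq> id" for \<sigma> using N' that .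
    qed
    then obtain f2 where f2: "f2 ` (P - Q) = P - Q" "\<forall>p\<in>P - Q. f2 p \<noteq> p"
      "\<forall>g\<in>G. \<forall>p\<in>P - Q. f2 (g p) = g (f2 p)" by blast
    define f where "f = (\<lambda>p. if p \<in> Q then f1 p else f2 p)"
    have "f ` P = f ` Q \<union> f ` (P - Q)" using QP by blast
    also have "f ` Q = Q" using f1(1) by (simp add: f_def)
    also have "f ` (P - Q) = P - Q" using f2(1) by (simp add: f_def)
    finally have "f ` P = P" using QP by blast
    moreover have "\<forall>p\<in>P. f p \<noteq> p" using f1(2) f2(2) by (simp add: f_def)
    moreover have "f (g p) = g (f p)" if g: "g \<in> G" and p: "p \<in> P" for g p
    proof (cases "p \<in> Q")
      case True
      then show ?thesis using f1(3) g gQ[OF g True] by (simp add: f_def)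
    next
      case False
      then have "g p \<notin> Q" using gQ'[OF g] by blast
      then show ?thesis using f2(3) g p False by (simp add: f_def)
    qed
    ultimately show ?thesis by blast
  qed auto
qed

section \<open>Similarities of the complex plane\<close>

text \<open>The conjugate form covers orientation-reversing maps, which occur because frames may
  have either handedness.\<close>

definition plane_similarities :: "(complex \<Rightarrow> complex) set" where
  "plane_similarities = {g. \<exists>a b. a \<noteq> 0 \<and> (g = (\<lambda>z. a * z + b) \<or> g = (\<lambda>z. a * cnj z + b))}"

lemma plane_similaritiesI:
  assumes "a \<noteq> 0" "(\<forall>z. g z = a * z + b) \<or> (\<forall>z. g z = a * cnj z + b)"
  shows "g \<in> plane_similarities"
  using assms unfolding plane_similarities_def fun_eq_iff by blast

lemma plane_similarities_cases:
  assumes "g \<in> plane_similarities"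
  obtains a b where "a \<noteq> 0" "\<And>z. g z = a * z + b" | a b where "a \<noteq> 0" "\<And>z. g z = a * cnj z + b"
  using assms unfolding plane_similarities_def fun_eq_iff by blast

lemma id_plane_similarities: "id \<in> plane_similarities"
  by (rule plane_similaritiesI[of 1 _ 0]) auto

lemma comp_plane_similarities:
  assumes "g \<in> plane_similarities" "h \<in> plane_similarities"
  shows "g \<circ> h \<in> plane_similarities"
  using assms(1)
proof (cases rule: plane_similarities_cases)
  case g: (1 a b)
  from assms(2) show ?thesis
  proof (cases rule: plane_similarities_cases)
    case (1 c d) with g show ?thesis
      by (intro plane_similaritiesI[of "a * c" _ "a * d + b"]) (auto simp: algebra_simps)
  next
    case (2 c d) with g show ?thesis
      by (intro plane_similaritiesI[of "a * c" _ "a * d + b"]) (auto simp: algebra_simps)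
  qed
next
  case g: (2 a b)
  from assms(2) show ?thesis
  proof (cases rule: plane_similarities_cases)
    case (1 c d) with g show ?thesis
      by (intro plane_similaritiesI[of "a * cnj c" _ "a * cnj d + b"]) (auto simp: algebra_simps)
  next
    case (2 c d) with g show ?thesis
      by (intro plane_similaritiesI[of "a * cnj c" _ "a * cnj d + b"]) (auto simp: algebra_simps)
  qed
qed

lemma inverse_plane_similarities:
  assumes "g \<in> plane_similarities"
  obtains h where "h \<in> plane_similarities" "h \<circ> g = id" "g \<circ> h = id"
  using assms
proof (cases rule: plane_similarities_cases)
  case (1 a b)
  let ?h = "\<lambda>z. inverse a * z + (- b / a)"
  have "?h \<in> plane_similarities" using 1 by (intro plane_similaritiesI[of "inverse a" _ "- b / a"]) auto
  moreover have "?h \<circ> g = id" "g \<circ> ?h = id" using 1 by (auto simp: fun_eq_iff field_simps)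
  ultimately show ?thesis by (rule that)
next
  case (2 a b)
  let ?h = "\<lambda>z. inverse (cnj a) * cnj z + (- cnj b / cnj a)"
  have "?h \<in> plane_similarities"
    using 2 by (intro plane_similaritiesI[of "inverse (cnj a)" _ "- cnj b / cnj a"]) auto
  moreover have "?h \<circ> g = id" "g \<circ> ?h = id" using 2 by (auto simp: fun_eq_iff field_simps)
  ultimately show ?thesis by (rule that)
qed

section \<open>The symmetry group of a finite planar set\<close>

definition centroid :: "complex set \<Rightarrow> complex" where
  "centroid P = \<Sum>P / of_nat (card P)"

definition set_symmetries :: "complex set \<Rightarrow> (complex \<Rightarrow> complex) set" where
  "set_symmetries P = {g \<in> plane_similarities. g ` P = P}"

lemma id_set_symmetries: "id \<in> set_symmetries P"
  by (simp add: set_symmetries_def id_plane_similarities)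

lemma comp_set_symmetries:
  "g \<in> set_symmetries P \<Longrightarrow> h \<in> set_symmetries P \<Longrightarrow> g \<circ> h \<in> set_symmetries P"
  unfolding set_symmetries_def using comp_plane_similarities image_comp[of g h P] by simp

lemma inverse_set_symmetries:
  assumes "g \<in> set_symmetries P"
  shows "\<exists>h\<in>set_symmetries P. h \<circ> g = id \<and> g \<circ> h = id"
proof -
  obtain h where h: "h \<in> plane_similarities" "h \<circ> g = id" "g \<circ> h = id"
    using assms inverse_plane_similarities unfolding set_symmetries_def by blast
  have "h ` P = h ` g ` P" using assms by (simp add: set_symmetries_def)
  then have "h ` P = P" using h(2) by (simp add: image_comp)
  then show ?thesis using h by (auto simp: set_symmetries_def)
qed

text \<open>Summing \<open>g\<close> over \<open>P\<close> shows that the centroid is fixed. The sum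
  of squared distances to the centroid is positive, since \<open>P\<close> has two points, and is
  scaled by the squared modulus of the linear coefficient, which is therefore 1.\<close>

lemma set_symmetries_cases:
  assumes g: "g \<in> set_symmetries P" and P: "finite P" "card P \<ge> 2"
  obtains (rotation) u where "norm u = 1" "g = (\<lambda>z. centroid P + u * (z - centroid P))"
  | (reflection) u where "norm u = 1" "g = (\<lambda>z. centroid P + u * cnj (z - centroid P))"
proof -
  define c where "c = centroid P"
  have nz: "of_nat (card P) \<noteq> (0::complex)" using P by auto
  have sumP: "\<Sum>P = of_nat (card P) * c" using nz by (simp add: c_def centroid_def)
  have inj: "inj_on g P" using g P(1) by (auto simp: set_symmetries_def intro: eq_card_imp_inj_on)
  have bij: "bij_betw g P P" using g inj by (auto simp: set_symmetries_def bij_betw_def)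
  have "\<exists>a b k. a \<noteq> 0 \<and> (k = id \<or> k = cnj) \<and> g = (\<lambda>z. a * k z + b)"
    using g unfolding set_symmetries_def plane_similarities_def id_def by blast
  \<comment> \<open>The map \<open>k\<close> is the identity or conjugation, so both kinds of
    similarity are treated at once.\<close>
  then obtain a b k where a: "a \<noteq> 0" and k: "k = id \<or> k = cnj" and gk: "g = (\<lambda>z. a * k z + b)" by blast
  have "of_nat (card P) * c = (\<Sum>z\<in>P. g z)" using sum.reindex_bij_betw[OF bij, of id] sumP by simp
  also have "\<dots> = a * k (\<Sum>P) + of_nat (card P) * b"
    using k by (auto simp: gk sum.distrib sum_distrib_left)
  also have "\<dots> = of_nat (card P) * (a * k c + b)" using k by (auto simp: sumP algebra_simps)
  finally have b: "a * k c + b = c" using nz by simp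
  have gc: "g = (\<lambda>z. c + a * k (z - c))"
  proof
    fix z
    have "k (z - c) = k z - k c" using k by auto
    then have "c + a * k (z - c) = (a * k c + b) + (a * k z - a * k c)"
      unfolding b by (simp add: right_diff_distrib)
    then show "g z = c + a * k (z - c)" by (simp add: gk)
  qed
  have nk: "norm (k z) = norm z" for z using k by auto
  define S where "S = (\<Sum>z\<in>P. (norm (z - c))\<^sup>2)"
  have "S = (\<Sum>z\<in>P. (norm (g z - c))\<^sup>2)"
    using sum.reindex_bij_betw[OF bij, of "\<lambda>z. (norm (z - c))\<^sup>2"] by (simp add: S_def)
  also have "\<dots> = (norm a)\<^sup>2 * S"
    by (simp add: gc S_def nk norm_mult power_mult_distrib sum_distrib_left)
  finally have SS: "S = (norm a)\<^sup>2 * S" .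
  obtain z where z: "z \<in> P" "z \<noteq> c"
  proof -
    have "\<not> P \<subseteq> {c}" using P(2) card_mono[of "{c}" P] by auto
    then show ?thesis using that by blast
  qed
  have "0 < (norm (z - c))\<^sup>2" using z by simp
  also have "\<dots> \<le> S" unfolding S_def using z(1) P(1) by (intro member_le_sum) auto
  finally have "(norm a)\<^sup>2 = 1" using SS by simp
  then have "norm a = 1" by (simp add: power2_eq_1_iff norm_eq_sqrt_inner)
  then show ?thesis using k gc that unfolding c_def by auto
qed

lemma cnj_mult_unit:
  assumes "norm u = 1"
  shows "u * cnj u = 1" "cnj u * u = 1"
  using assms complex_norm_square[of u] by (simp_all add: mult.commute)

lemma real_unit_cases:
  fixes v :: complex
  assumes "norm v = 1" "cnj v = v"
  shows "v = 1 \<or> v = - 1"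
proof -
  have "v * v = 1" using cnj_mult_unit(1)[OF assms(1)] assms(2) by simp
  then show ?thesis by (simp add: square_eq_1_iff)
qed

text \<open>The obstacle to the condition on pairs in
  \<open>equivariant_derangement_nontrivial\<close> is the point reflection \<open>m\<close> in the
  centroid, which preserves every axis through it without fixing the axis pointwise. If
  \<open>m\<close> is a symmetry, it serves as the derangement itself: it commutes with all
  symmetries, and the centroid is unoccupied because it would be the only fixed point of
  \<open>m\<close>.\<close>

lemma equivariant_derangement:
  assumes P: "finite P" "card P \<ge> 2"
    and N: "\<And>g. g \<in> set_symmetries P \<Longrightarrow> g \<noteq> id \<Longrightarrow> card {p \<in> P. g p = p} \<noteq> 1"
  obtains f where "f ` P = P" "\<And>p. p \<in> P \<Longrightarrow> f p \<noteq> p"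
    "\<And>g p. g \<in> set_symmetries P \<Longrightarrow> p \<in> P \<Longrightarrow> f (g p) = g (f p)"
proof -
  define c where "c = centroid P"
  define m where "m = (\<lambda>z. c - (z - c))"
  note cases = set_symmetries_cases[OF _ P, folded c_def, consumes 1, case_names rotation reflection]
  consider "set_symmetries P = {id}" | "m \<in> set_symmetries P"
    | "m \<notin> set_symmetries P" "set_symmetries P \<noteq> {id}" by blast
  then have "\<exists>f. f ` P = P \<and> (\<forall>p\<in>P. f p \<noteq> p) \<and> (\<forall>g\<in>set_symmetries P. \<forall>p\<in>P. f (g p) = g (f p))"
  proof cases
    case 1
    then show ?thesis using fixpoint_free_surjection_exists[of P] P by auto
  next
    case 2
    have mfix: "m z = z \<longleftrightarrow> z = c" for z by (auto simp: m_def complex_eq_iff)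
    have "m (c + 1) \<noteq> c + 1" by (simp add: mfix)
    then have "m \<noteq> id" by auto
    then have "card {p \<in> P. p = c} \<noteq> 1" using N[OF 2] by (simp add: mfix)
    moreover have "{p \<in> P. p = c} = {c}" if "c \<in> P" using that by blast
    ultimately have cP: "c \<notin> P" by auto
    have "m (g p) = g (m p)" if "g \<in> set_symmetries P" for g p
      using that by (cases rule: cases) (auto simp: m_def algebra_simps)
    moreover have "m ` P = P" using 2 by (simp add: set_symmetries_def)
    moreover have "m p \<noteq> p" if "p \<in> P" for p using mfix[of p] cP that by auto
    ultimately show ?thesis by (intro exI[of _ m]) blast
  next
    case 3
    then obtain g0 where g0: "g0 \<in> set_symmetries P" "g0 \<noteq> id" using id_set_symmetries by blast
    \<comment> \<open>A nontrivial rotation about an occupied centroid would fix exactly one point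
      of \<open>P\<close>, against \<open>N\<close>.\<close>
    have rot: "u = 1" if "c \<in> P" "(\<lambda>z. c + u * (z - c)) \<in> set_symmetries P" for u
    proof (rule ccontr)
      assume u: "u \<noteq> 1"
      have "{p \<in> P. c + u * (p - c) = p} = {c}"
      proof -
        have "p = c" if "c + u * (p - c) = p" for p
        proof -
          have "(u - 1) * (p - c) = 0" using that by (simp add: algebra_simps)
          then show ?thesis using u by simp
        qed
        then show ?thesis using \<open>c \<in> P\<close> by auto
      qed
      moreover have "(\<lambda>z. c + u * (z - c)) \<noteq> id"
      proof
        assume "(\<lambda>z. c + u * (z - c)) = id"
        then have "c + u * (c + 1 - c) = c + 1" by (metis id_apply)
        then show False using u by simp
      qed
      ultimately show False using N that(2) by fastforce
    qed
    have K: "g = id \<or> g = \<sigma>" if g: "g \<in> set_symmetries P" and s: "\<sigma> \<in> set_symmetries P" "\<sigma> \<noteq> id"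
      and b: "b \<in> P" "\<sigma> b = b" "\<sigma> (g b) = g b" for g \<sigma> b
    proof -
      have gs: "g \<circ> \<sigma> \<in> set_symmetries P" using g s comp_set_symmetries by blast
      \<comment> \<open>A rotation fixing \<open>b\<close> is trivial: if \<open>b\<close> is not
        the centre this is immediate, and if it is, the centre is occupied and \<open>rot\<close>
        applies. Hence \<sigma> is a reflection.\<close>
      have "\<exists>u. norm u = 1 \<and> \<sigma> = (\<lambda>z. c + u * cnj (z - c))"
        using s(1)
      proof (cases rule: cases)
        case (rotation u)
        have "c \<in> P"
        proof (rule ccontr)
          assume "c \<notin> P"
          then have "b - c \<noteq> 0" using b by auto
          moreover have "(u - 1) * (b - c) = 0" using b(2) rotation by (simp add: algebra_simps)
          ultimately have "u = 1" by simp
          then show False using s rotation by (auto simp: fun_eq_iff)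
        qed
        then have "u = 1" using rot s(1) rotation by blast
        then show ?thesis using s rotation by (auto simp: fun_eq_iff)
      qed auto
      then obtain u where u: "norm u = 1" "\<sigma> = (\<lambda>z. c + u * cnj (z - c))" by blast
      note uu = cnj_mult_unit[OF u(1)]
      have ub: "u * cnj (b - c) = b - c" using b(2) u(2) by (simp add: algebra_simps)
      have ub': "cnj (b - c) = cnj u * (b - c)" using arg_cong[OF ub, of cnj] by simp
      from g show ?thesis
      proof (cases rule: cases)
        case (rotation v)
        show ?thesis
        proof (cases "c \<in> P")
          case True
          then have "v = 1" using rot g rotation by blast
          then show ?thesis using rotation by (auto simp: fun_eq_iff)
        next
          case False
          then have ne: "b - c \<noteq> 0" using b by auto
          \<comment> \<open>Both \<open>b\<close> and \<open>g b\<close> lie on the axis of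
            \<sigma>, so \<open>v\<close> is real. The value -1 would make \<open>g\<close> the
            point reflection \<open>m\<close>, which is excluded in this case.\<close>
          have "u * cnj (v * (b - c)) = v * (b - c)" using b(3) u(2) rotation(2) by simp
          moreover have "u * cnj (v * (b - c)) = cnj v * (u * cnj (b - c))" by simp
          ultimately have "cnj v * (b - c) = v * (b - c)" by (simp only: ub)
          then have "cnj v = v" unfolding mult_right_cancel[OF ne] .
          then have "v = 1 \<or> v = - 1" by (rule real_unit_cases[OF rotation(1)])
          moreover have "v \<noteq> - 1" using 3(1) g rotation(2) by (auto simp: m_def)
          ultimately show ?thesis using rotation by (auto simp: fun_eq_iff)
        qed
      next
        case (reflection v)
        \<comment> \<open>Composing two reflections reduces to the rotation argument: the
          coefficient \<open>v * cnj u\<close> is again real and not -1, so \<open>g\<close> equals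
          \<sigma>.\<close>
        have comp: "g \<circ> \<sigma> = (\<lambda>z. c + (v * cnj u) * (z - c))"
          using u reflection by (auto simp: fun_eq_iff)
        have "v * cnj u = 1"
        proof (cases "c \<in> P")
          case True
          then show ?thesis using rot gs comp by simp
        next
          case False
          then have ne: "b - c \<noteq> 0" using b by auto
          have "u * cnj (v * cnj (b - c)) = v * cnj (b - c)" using b(3) u(2) reflection(2) by simp
          moreover have "u * cnj (v * cnj (b - c)) = (u * cnj v) * (b - c)" by simp
          moreover have "v * cnj (b - c) = (v * cnj u) * (b - c)" by (simp only: ub' mult.assoc)
          ultimately have "(u * cnj v) * (b - c) = (v * cnj u) * (b - c)" by (simp only:)
          then have "u * cnj v = v * cnj u" unfolding mult_right_cancel[OF ne] .
          then have "cnj (v * cnj u) = v * cnj u" by (simp add: mult.commute)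
          then have "v * cnj u = 1 \<or> v * cnj u = - 1"
            using real_unit_cases[of "v * cnj u"] u(1) reflection(1) by (simp only: norm_mult complex_mod_cnj mult_1_left)
          moreover have "v * cnj u \<noteq> - 1" using 3(1) gs comp by (auto simp: m_def)
          ultimately show ?thesis by blast
        qed
        then have "(v * cnj u) * u = u" by (simp only: mult_1_left)
        then have "v = u" by (simp only: mult.assoc uu mult_1_right)
        then show ?thesis using reflection u by simp
      qed
    qed
    show ?thesis
      by (rule equivariant_derangement_nontrivial[OF id_set_symmetries comp_set_symmetries
            inverse_set_symmetries g0 P(1) _ K N])
        (auto simp: set_symmetries_def)
  qed
  then obtain f where "f ` P = P" "\<forall>p\<in>P. f p \<noteq> p"
    "\<forall>g\<in>set_symmetries P. \<forall>p\<in>P. f (g p) = g (f p)" by (elim exE conjE)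
  then show ?thesis by (intro that[of f]) blast+
qed

section \<open>Configurations as sets of complex numbers\<close>

definition cx :: "point \<Rightarrow> complex" where "cx v = Complex (v $ 1) (v $ 2)"

definition pt :: "complex \<Rightarrow> point" where "pt z = vector [Re z, Im z]"

lemma cx_pt [simp]: "cx (pt z) = z"
  by (simp add: cx_def pt_def)

lemma pt_cx [simp]: "pt (cx v) = v"
  by (simp add: cx_def pt_def vec_eq_iff forall_2)

lemma cx_vector [simp]: "cx (vector [a, b]) = Complex a b"
  by (simp add: cx_def)

lemma cx_eq_iff: "cx v = cx w \<longleftrightarrow> v = w"
  by (metis pt_cx)

lemma cx_linear: "cx (v + w) = cx v + cx w" "cx (v - w) = cx v - cx w"
  "cx (r *\<^sub>R v) = of_real r * cx v"
  by (simp_all add: cx_def complex_eq_iff)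

lemma inner_cx: "v \<bullet> w = Re (cx v * cnj (cx w))"
  by (simp add: cx_def inner_vec_def sum_2)

lemma norm_cx: "norm (cx v) = norm v"
  by (simp add: cx_def norm_vec_def L2_set_def sum_2 cmod_def)

lemma dist_cx: "dist (cx v) (cx w) = dist v w"
  by (simp add: dist_norm norm_cx flip: cx_linear)

text \<open>In complex terms the second axis is the first one turned by a right angle in one of the
  two directions. The direction is the handedness of the frame and decides whether conjugation
  appears.\<close>

lemma cx_to_local:
  assumes "cartesian z"
  shows "(\<lambda>w. cx (to_local z p (pt w))) \<in> plane_similarities"
proof -
  define X Y l where "X = cx (x_axis z)" and "Y = cx (y_axis z)" and "l = unit_length z"
  have l: "l > 0" and X: "norm X = 1" and Y: "norm Y = 1" and XY: "Re (X * cnj Y) = 0"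
    using assms by (auto simp: cartesian_def X_def Y_def l_def norm_cx inner_cx)
  note XX = cnj_mult_unit[OF X] and YY = cnj_mult_unit[OF Y]
  have loc: "cx (to_local z p (pt w)) =
      (of_real (Re ((w - cx p) * cnj X)) + \<i> * of_real (Re ((w - cx p) * cnj Y))) / of_real l" for w
    by (simp add: to_local_def inner_cx cx_linear X_def Y_def l_def complex_eq_iff)
  \<comment> \<open>The sign of the frame: 1 if it is positively oriented, -1 otherwise.\<close>
  define s where "s = Im (Y * cnj X)"
  have YX: "Y = \<i> * of_real s * X"
  proof -
    have "Y * cnj X = \<i> * of_real s" using XY by (simp add: complex_eq_iff s_def algebra_simps)
    then have "(Y * cnj X) * X = \<i> * of_real s * X" by simp
    then show ?thesis by (simp only: mult.assoc XX mult_1_right)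
  qed
  have "\<bar>s\<bar> = 1" using Y X unfolding YX by (simp add: norm_mult)
  then have s: "s = 1 \<or> s = - 1" by auto
  have re: "of_real (Re v) = (v + cnj v) / 2" for v by (simp add: complex_eq_iff)
  from s show ?thesis
  proof
    assume s1: "s = 1"
    have "cx (to_local z p (pt w)) = cnj X / of_real l * w + (- cnj X * cx p / of_real l)" for w
      unfolding loc YX s1 re using l by (simp add: field_simps)
    then show ?thesis using l X by (intro plane_similaritiesI[of "cnj X / of_real l"]) auto
  next
    assume s1: "s = - 1"
    have "cx (to_local z p (pt w)) = X / of_real l * cnj w + (- X * cnj (cx p) / of_real l)" for w
      unfolding loc YX s1 re using l by (simp add: field_simps)
    then show ?thesis using l X by (intro plane_similaritiesI[of "X / of_real l"]) auto
  qed
qed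

lemma to_local_to_global:
  assumes "cartesian z"
  shows "to_local z p (to_global z p v) = v"
  using assms
  by (simp add: cartesian_def to_local_def to_global_def vec_eq_iff forall_2 inner_add_left
      inner_commute[of "y_axis z" "x_axis z"] norm_eq_1)

text \<open>As a similarity, \<open>to_local\<close> is injective, so the one-sided inverse
  \<open>to_global\<close> is two-sided.\<close>

lemma to_global_to_local:
  assumes "cartesian z"
  shows "to_global z p (to_local z p q) = q"
proof -
  obtain h where h: "h \<circ> (\<lambda>w. cx (to_local z p (pt w))) = id"
    using inverse_plane_similarities[OF cx_to_local[OF assms]] by metis
  have inj: "to_local z p a = to_local z p b \<Longrightarrow> a = b" for a b
    using fun_cong[OF h, of "cx a"] fun_cong[OF h, of "cx b"] by (simp add: cx_eq_iff)
  show ?thesis by (rule inj) (rule to_local_to_global[OF assms])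
qed

lemma to_local_self: "cx (to_local z p p) = 0"
  by (simp add: to_local_def cx_def complex_eq_iff)

lemma set_points: "set_mset (points n C) = C ` {..<n}"
  by (simp add: points_def)

text \<open>Positions are pairwise distinct, so the multiset carries no more information than its
  set of points.\<close>

lemma points_invariant:
  assumes "initial_config n C" "inj_on g (C ` {..<n})" "g ` C ` {..<n} = C ` {..<n}"
  shows "image_mset g (points n C) = points n C"
proof -
  have "points n C = mset_set (C ` {..<n})"
    using assms(1) by (simp add: points_def initial_config_def image_mset_mset_set)
  then show ?thesis using assms(2,3) by (simp add: image_mset_mset_set)
qed

section \<open>Impossibility by transporting frames along a symmetry\<close>

definition transform_frame :: "(point \<Rightarrow> point) \<Rightarrow> frame \<Rightarrow> frame" where
  "transform_frame A z =
     \<lparr>unit_length = unit_length z, x_axis = A (x_axis z), y_axis = A (y_axis z)\<rparr>"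

text \<open>The point \<open>g q\<close> has the same coordinates in the transported frame at
  \<open>g (C i)\<close> as \<open>q\<close> has in the original frame at \<open>C i\<close>. Both
  robots thus see the same snapshot, choose the same local destination, and their global
  destinations correspond under \<open>g\<close>. The axes are transported by the linear part
  \<open>A\<close>, the origin by \<open>g\<close>.\<close>

lemma move_equivariant:
  assumes A: "orthogonal_transformation A" and g: "\<And>x y. g x - g y = A (x - y)"
    and inv: "image_mset g (points n C) = points n C"
    and ij: "C j = g (C i)" "Z' j = transform_frame A (Z i)"
  shows "move n F Z' C j = g (move n F Z C i)"
proof -
  have lin: "linear A" and inner: "A x \<bullet> A y = x \<bullet> y" for x y
    using A by (auto simp: orthogonal_transformation_def)
  have loc: "to_local (Z' j) (C j) (g q) = to_local (Z i) (C i) q" for q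
    by (simp add: to_local_def ij transform_frame_def g inner)
  have "snapshot n Z' C j = image_mset (to_local (Z' j) (C j)) (image_mset g (points n C))"
    by (simp add: snapshot_def inv)
  also have "\<dots> = snapshot n Z C i" by (simp add: snapshot_def image_mset.compositionality comp_def loc)
  finally have snap: "snapshot n Z' C j = snapshot n Z C i" .
  have gl: "g (p + w) = g p + A w" for p w using g[of "p + w" p] by (simp add: algebra_simps)
  show ?thesis
    by (simp add: move_def snap to_global_def gl ij transform_frame_def linear_add[OF lin] linear_scale[OF lin])
qed

text \<open>
  If \<open>i\<close> moves to the fixed robot, giving the robot at \<open>g (C i)\<close> the transported frame of \<open>i\<close>
  makes both robots move there.
\<close>
lemma unsolvable_if_unique_fixed_robot:
  assumes A: "orthogonal_transformation A" and g: "\<And>x y. g x - g y = A (x - y)"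
    and init: "initial_config n C" and inv: "g ` C ` {..<n} = C ` {..<n}"
    and ex1: "\<exists>!i. i < n \<and> g (C i) = C i"
  shows "\<not> move_all_1_solvable n C"
proof
  assume "move_all_1_solvable n C"
  then obtain F where F: "solves_move_all_1 n F C" by (auto simp: move_all_1_solvable_def)
  have inner: "A x \<bullet> A y = x \<bullet> y" for x y
    using A by (auto simp: orthogonal_transformation_def)
  \<comment> \<open>The contradiction already arises in the first round,
    \<open>t = 1\<close>.\<close>
  have step: "\<exists>\<pi>. \<pi> permutes {..<n} \<and> (\<forall>i<n. \<pi> i \<noteq> i) \<and> (\<forall>j<n. move n F Z C j = C (\<pi> j))"
    if "admissible n Z" for Z
  proof -
    obtain \<pi> where pi: "\<pi> \<in> fixpoint_free_perms n"
      "\<forall>t. \<forall>j<n. run n F Z C t j = permute_config (\<pi> ^^ t) C j"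
      using F \<open>admissible n Z\<close> unfolding solves_move_all_1_def by blast
    have "\<forall>j<n. move n F Z C j = C (\<pi> j)"
      using spec[OF pi(2), of 1] by (simp add: run_def permute_config_def)
    then show ?thesis using pi(1) by (auto simp: fixpoint_free_perms_def)
  qed
  have injC: "inj_on C {..<n}" using init by (simp add: initial_config_def)
  have "inj g"
  proof (rule injI)
    fix x y assume "g x = g y"
    then have "A (x - y) = 0" using g[of x y] by simp
    then have "(x - y) \<bullet> (x - y) = 0" using inner[of "x - y" "x - y"] by simp
    then show "x = y" by simp
  qed
  then have ptsg: "image_mset g (points n C) = points n C"
    using inv init by (intro points_invariant) (auto intro: inj_on_subset)
  obtain c where c: "c < n" "g (C c) = C c" and uniq: "\<And>i. i < n \<Longrightarrow> g (C i) = C i \<Longrightarrow> i = c"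
    using ex1 by blast
  define z :: frame where "z = \<lparr>unit_length = 1, x_axis = axis 1 1, y_axis = axis 2 1\<rparr>"
  have z: "cartesian z" by (simp add: z_def cartesian_def inner_axis_axis)
  define Z where "Z = (\<lambda>i::nat. z)"
  obtain \<pi> where pi: "\<pi> permutes {..<n}" "\<forall>i<n. \<pi> i \<noteq> i" "\<forall>j<n. move n F Z C j = C (\<pi> j)"
    using step[of Z] z by (auto simp: Z_def admissible_def)
  obtain i where i: "i < n" "\<pi> i = c"
    using permutes_image[OF pi(1)] c(1) by (metis imageE lessThan_iff)
  have "g (C i) \<in> C ` {..<n}" using inv i(1) by blast
  then obtain j where j: "j < n" "C j = g (C i)" by auto
  \<comment> \<open>The robot \<open>i\<close> moves to \<open>c\<close>, so it is not
    \<open>c\<close> itself and is not fixed by \<open>g\<close>.\<close>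
  have "j \<noteq> i" using uniq[OF i(1)] j i pi(2) by auto
  define Z' where "Z' = Z(j := transform_frame A z)"
  have "admissible n Z'"
    using z unfolding admissible_def Z'_def Z_def
    by (auto simp: cartesian_def transform_frame_def norm_eq_sqrt_inner inner)
  then obtain \<pi>' where pi': "\<pi>' permutes {..<n}" "\<forall>j<n. move n F Z' C j = C (\<pi>' j)"
    using step by blast
  have mi: "move n F Z C i = C c" using pi(3) i by simp
  \<comment> \<open>Only the frame of \<open>j\<close> has been replaced, so \<open>i\<close> still
    moves to the fixed robot.\<close>
  have "move n F Z' C i = move n F Z C i" using \<open>j \<noteq> i\<close> by (simp add: move_def snapshot_def Z'_def)
  moreover have "move n F Z' C j = g (move n F Z C i)"
    by (rule move_equivariant[OF A g ptsg j(2)]) (simp add: Z'_def Z_def)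
  ultimately have "C (\<pi>' i) = C (\<pi>' j)" using pi'(2) i j mi c by simp
  moreover have "\<pi>' i < n" "\<pi>' j < n" using permutes_in_image[OF pi'(1)] i j by auto
  ultimately have "\<pi>' i = \<pi>' j" using injC by (auto dest: inj_onD)
  then show False using permutes_inj[OF pi'(1)] \<open>j \<noteq> i\<close> by (auto dest: injD)
qed

section \<open>Rotational symmetry about a robot\<close>

lemma cx_rotate_about: "cx (rotate_about c \<theta> q) = cx c + cis \<theta> * (cx q - cx c)"
  by (simp add: rotate_about_def cx_def complex_eq_iff)

lemma cis_ne_1:
  assumes "k > (1::nat)"
  shows "cis (2 * pi / real k) \<noteq> 1"
proof
  assume "cis (2 * pi / real k) = 1"
  then have "cos (2 * pi / real k) = 1" by (metis cis.sel(1) one_complex.sel(1))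
  then obtain m :: int where m: "2 * pi / real k = of_int m * 2 * pi" by (auto simp: cos_one_2pi_int)
  then have "of_int (m * int k) = (1::real)" using assms by (simp add: field_simps)
  then have "m * int k = 1" by (simp only: of_int_eq_1_iff)
  then show False using assms by (auto simp: zmult_eq_1_iff)
qed

text \<open>A rotation by \<open>2 * pi / k\<close> with \<open>k > 1\<close> fixes only its centre,
  which exactly one robot occupies.\<close>

lemma C_odot_unsolvable:
  assumes "initial_config n C" "C \<in> C_odot n"
  shows "\<not> move_all_1_solvable n C"
proof -
  obtain c k where c: "\<exists>!i. i < n \<and> C i = c" and k: "(k::nat) > 1"
    and pts: "image_mset (rotate_about c (2 * pi / real k)) (points n C) = points n C"
    using assms(2) unfolding C_odot_def by blast
  define \<theta> where "\<theta> = 2 * pi / real k"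
  define A :: "point \<Rightarrow> point" where "A w = pt (cis \<theta> * cx w)" for w
  have A: "orthogonal_transformation A"
    unfolding orthogonal_transformation_def
  proof
    show "linear A"
      by (rule linearI) (simp_all flip: cx_eq_iff add: A_def cx_linear algebra_simps)
    have "cis \<theta> * x * cnj (cis \<theta> * y) = (cis \<theta> * cnj (cis \<theta>)) * (x * cnj y)" for x y
      by (simp only: complex_cnj_mult ac_simps)
    then have "cis \<theta> * x * cnj (cis \<theta> * y) = x * cnj y" for x y
      by (simp only: cnj_mult_unit[OF norm_cis] mult_1_left)
    then show "\<forall>v w. A v \<bullet> A w = v \<bullet> w" by (simp only: A_def inner_cx cx_pt) simp
  qed
  have g: "rotate_about c \<theta> x - rotate_about c \<theta> y = A (x - y)" for x y
    by (simp flip: cx_eq_iff add: A_def cx_linear cx_rotate_about algebra_simps)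
  have fixd: "rotate_about c \<theta> q = q \<longleftrightarrow> q = c" for q
  proof -
    have "rotate_about c \<theta> q = q \<longleftrightarrow> (cis \<theta> - 1) * (cx q - cx c) = 0"
      unfolding cx_eq_iff[symmetric] cx_rotate_about by (auto simp: algebra_simps)
    then show ?thesis using cis_ne_1[OF k] by (simp add: cx_eq_iff \<theta>_def)
  qed
  show ?thesis
  proof (rule unsolvable_if_unique_fixed_robot[OF A g assms(1)])
    show "rotate_about c \<theta> ` C ` {..<n} = C ` {..<n}"
      using arg_cong[OF pts, of set_mset] by (simp add: set_points \<theta>_def)
    show "\<exists>!i. i < n \<and> rotate_about c \<theta> (C i) = C i" using c by (simp add: fixd)
  qed
qed

section \<open>Lines and reflections\<close>

lemma line_range:
  assumes "norm d = 1"
  shows "line (range (\<lambda>t. a + t *\<^sub>R d))"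
proof -
  have "range (\<lambda>t. a + t *\<^sub>R d) = affine hull {a, a + d}" by (simp add: affine_hull_2_alt)
  moreover have "a \<noteq> a + d" using assms by auto
  ultimately show ?thesis by (simp add: line_def)
qed

text \<open>Passes from affine dimension to a parametrisation on which reflections can be computed:
  the line through two points of \<open>L\<close> is contained in \<open>L\<close> and has the same
  dimension.\<close>

lemma line_cases:
  assumes "line L"
  obtains a d where "norm d = 1" "L = range (\<lambda>t. a + t *\<^sub>R d)"
proof -
  have L: "affine L" "aff_dim L = 1" using assms by (auto simp: line_def)
  then have "L \<noteq> {}" "\<nexists>a. L = {a}" by (auto simp flip: aff_dim_eq_0)
  then obtain a b where ab: "a \<in> L" "b \<in> L" "a \<noteq> b" by (metis is_singletonI' is_singleton_def)
  define d where "d = (b - a) /\<^sub>R norm (b - a)"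
  have d: "norm d = 1" using ab by (simp add: d_def)
  let ?R = "range (\<lambda>t. a + t *\<^sub>R d)"
  have "?R \<subseteq> L"
  proof -
    have "a + t *\<^sub>R d \<in> L" for t
      using mem_affine_3_minus[OF L(1) ab(1,2,1), of "t / norm (b - a)"]
      by (simp add: d_def divide_inverse)
    then show ?thesis by blast
  qed
  moreover have "line ?R" using d by (rule line_range)
  ultimately have "?R = L" using L by (intro affine_dim_equal) (auto simp: line_def)
  then show ?thesis using d that by blast
qed

lemma reflect_in_line:
  fixes a d :: point
  assumes "norm d = 1"
  shows "reflect_in (range (\<lambda>t. a + t *\<^sub>R d)) q = 2 *\<^sub>R (a + ((q - a) \<bullet> d) *\<^sub>R d) - q"
proof -
  let ?R = "range (\<lambda>t. a + t *\<^sub>R d)"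
  have dd: "d \<bullet> d = 1" using assms by (simp add: norm_eq_1)
  have aff: "affine ?R" using line_range[OF assms] by (simp add: line_def)
  have "a + ((q - a) \<bullet> d) *\<^sub>R d = closest_point ?R q"
  proof (rule closest_point_unique)
    show "convex ?R" "closed ?R" using aff by (auto intro: affine_imp_convex affine_closed)
    show "\<forall>z\<in>?R. dist q (a + ((q - a) \<bullet> d) *\<^sub>R d) \<le> dist q z"
    proof clarify
      fix t
      \<comment> \<open>Completing the square in \<open>t\<close>: the distance is least at
        \<open>t = w \<bullet> d\<close>.\<close>
      have nn: "(norm (w - t *\<^sub>R d))\<^sup>2 = w \<bullet> w + (t - w \<bullet> d)\<^sup>2 - (w \<bullet> d)\<^sup>2" for t and w :: point
        unfolding power2_norm_eq_inner
        by (simp add: inner_diff_left inner_diff_right dd inner_commute[of d w] power2_eq_square algebra_simps)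
      have "(norm ((q - a) - ((q - a) \<bullet> d) *\<^sub>R d))\<^sup>2 \<le> (norm ((q - a) - t *\<^sub>R d))\<^sup>2"
        unfolding nn by simp
      then show "dist q (a + ((q - a) \<bullet> d) *\<^sub>R d) \<le> dist q (a + t *\<^sub>R d)"
        by (simp add: dist_norm diff_diff_eq power2_le_iff_abs_le)
    qed
  qed auto
  then show ?thesis by (simp add: reflect_in_def)
qed

text \<open>Brings reflections into the form used in \<open>set_symmetries_cases\<close>; the unit
  coefficient is the square of the direction of the axis.\<close>

lemma cx_reflect_in_line:
  assumes "norm d = 1"
  shows "cx (reflect_in (range (\<lambda>t. a + t *\<^sub>R d)) q) = cx a + (cx d)\<^sup>2 * cnj (cx q - cx a)"
proof -
  have dd: "cx d * cnj (cx d) = 1" using assms by (intro cnj_mult_unit) (simp add: norm_cx)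
  define w where "w = cx q - cx a"
  have re: "2 * of_real (Re (w * cnj (cx d))) = w * cnj (cx d) + cnj w * cx d" by (simp add: complex_eq_iff)
  have "(q - a) \<bullet> d = Re (w * cnj (cx d))" by (simp only: inner_cx cx_linear w_def)
  then have "cx (reflect_in (range (\<lambda>t. a + t *\<^sub>R d)) q)
      = 2 * cx a + (2 * of_real (Re (w * cnj (cx d)))) * cx d - cx q"
    unfolding reflect_in_line[OF assms] by (simp only: cx_linear of_real_numeral distrib_left mult.assoc)
  also have "\<dots> = 2 * cx a + (w * cnj (cx d) + cnj w * cx d) * cx d - cx q" by (simp only: re)
  also have "\<dots> = 2 * cx a + w * (cx d * cnj (cx d)) + cnj w * (cx d)\<^sup>2 - cx q"
    by (simp add: algebra_simps power2_eq_square)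
  also have "\<dots> = cx a + (cx d)\<^sup>2 * cnj w" unfolding dd by (simp add: w_def algebra_simps)
  finally show ?thesis by (simp add: w_def)
qed

lemma reflect_in_fixed_iff:
  assumes "line L"
  shows "reflect_in L q = q \<longleftrightarrow> q \<in> L"
proof -
  have L: "closed L" "L \<noteq> {}"
    using assms by (auto simp: line_def affine_closed)
  have "reflect_in L q = q \<longleftrightarrow> closest_point L q = q"
    by (auto simp: reflect_in_def vec_eq_iff)
  then show ?thesis using closest_point_refl[OF L] by simp
qed

text \<open>The fixed points of a reflection are the points of its axis, so exactly one robot is
  fixed.\<close>

lemma axis_with_one_robot_unsolvable:
  assumes "initial_config n C" "symmetry_axis n C L" "\<exists>!i. i < n \<and> C i \<in> L"
  shows "\<not> move_all_1_solvable n C"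
proof -
  have L: "line L" and inv: "reflect_in L ` C ` {..<n} = C ` {..<n}"
    using assms(2) by (auto simp: symmetry_axis_def)
  obtain a d where d: "norm d = 1" "L = range (\<lambda>t. a + t *\<^sub>R d)" using line_cases[OF L] .
  have dd: "d \<bullet> d = 1" using d by (simp add: norm_eq_1)
  define A :: "point \<Rightarrow> point" where "A w = (2 * (w \<bullet> d)) *\<^sub>R d - w" for w
  have A: "orthogonal_transformation A"
    unfolding orthogonal_transformation_def
  proof
    show "linear A"
      by (rule linearI) (simp_all add: A_def inner_add_left algebra_simps)
    show "\<forall>v w. A v \<bullet> A w = v \<bullet> w"
      by (simp add: A_def inner_diff_left inner_diff_right dd inner_commute algebra_simps)
  qed
  have g: "reflect_in L x - reflect_in L y = A (x - y)" for x y
    unfolding d(2) reflect_in_line[OF d(1)] by (simp add: A_def inner_diff_left algebra_simps)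
  show ?thesis
    by (rule unsolvable_if_unique_fixed_robot[OF A g assms(1) inv])
      (use assms(3) in \<open>simp add: reflect_in_fixed_iff[OF L]\<close>)
qed

section \<open>Solvability\<close>

lemma finite_order_unit:
  fixes u :: complex
  assumes "finite P" "p \<in> P" "p \<noteq> c"
    and inv: "\<And>z. z \<in> P \<Longrightarrow> c + u * (z - c) \<in> P" and u: "norm u = 1"
  obtains N where "N > 0" "u ^ N = 1"
proof -
  have mem: "c + u ^ j * (p - c) \<in> P" for j
  proof (induction j)
    case (Suc j)
    then show ?case using inv[OF Suc] by (simp add: mult.assoc)
  qed (use assms in simp)
  have "range (\<lambda>j. c + u ^ j * (p - c)) \<subseteq> P" using mem by blast
  \<comment> \<open>Pigeonhole: the orbit of \<open>p\<close> stays in the finite set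
    \<open>P\<close>, so two powers of \<open>u\<close> agree.\<close>
  then have "\<not> inj (\<lambda>j::nat. c + u ^ j * (p - c))"
    using finite_subset[OF _ assms(1)] finite_imageD infinite_UNIV_nat by blast
  then obtain i j :: nat where "i \<noteq> j" "c + u ^ i * (p - c) = c + u ^ j * (p - c)"
    by (auto simp: inj_def)
  then have "\<exists>i j. i < j \<and> u ^ i = u ^ j" using assms(3) by (metis add_left_cancel eq_iff_diff_eq_0 linorder_neq_iff mult_right_cancel)
  then obtain i j where ij: "i < j" "u ^ i = u ^ j" by blast
  have "u ^ j = u ^ i * u ^ (j - i)" using ij(1) by (simp flip: power_add)
  moreover have "u \<noteq> 0" using u by auto
  ultimately have "u ^ (j - i) = 1" using ij(2) by simp
  then show ?thesis using ij(1) that[of "j - i"] by simp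
qed

text \<open>\<open>C_odot\<close> asks for an angle of the exact form \<open>2 * pi / k\<close>.
  Write the angle of \<open>u\<close> as a fraction of the full turn, in lowest terms
  \<open>a' / k\<close>; a multiplicative inverse of \<open>a'\<close> modulo \<open>k\<close> is
  the required exponent.\<close>

lemma root_of_unity_generates:
  assumes N: "N > 0" "u ^ N = 1" and u: "(u::complex) \<noteq> 1"
  obtains k m :: nat where "k > 1" "u ^ m = cis (2 * pi / real k)"
proof -
  have "u \<in> (\<lambda>k. cis (2 * pi * real k / real N)) ` {..<N}"
    using Complex.bij_betw_roots_unity[OF N(1)] N(2) by (auto simp: bij_betw_def)
  then obtain a where a: "u = cis (2 * pi * real a / real N)" by blast
  have a0: "a \<noteq> 0"
  proof
    assume "a = 0"
    then show False using a u by simp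
  qed
  define d where "d = gcd a N"
  obtain a' k where ak: "a = d * a'" "N = d * k" unfolding d_def by (meson dvd_def gcd_dvd1 gcd_dvd2)
  have d0: "d \<noteq> 0" using N(1) by (simp add: d_def)
  have "gcd a' k = 1" using ak d_def d0 by (metis gcd_mult_distrib_nat mult_eq_self_implies_10)
  moreover have "a' \<noteq> 0" using a0 ak by auto
  \<comment> \<open>Bezout: \<open>m\<close> inverts \<open>a'\<close> modulo \<open>k\<close>, and
    \<open>y\<close> counts the full turns discarded below.\<close>
  ultimately obtain m y where m: "a' * m = k * y + 1" using bezout_nat[of a' k] by auto
  have k0: "k > 0" using N(1) ak by auto
  have "2 * pi * real a / real N = 2 * pi * real a' / real k" using d0 unfolding ak by simp
  then have ua: "u = cis (2 * pi * real a' / real k)" by (simp only: a)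
  have per: "cis (2 * pi * real y) = 1" for y :: nat by (metis cis_multiple_2pi Ints_of_nat)
  have "k \<noteq> 1"
  proof
    assume "k = 1"
    then show False using ua u per[of a'] by simp
  qed
  have "u ^ m = cis (real m * (2 * pi * real a' / real k))" by (simp only: ua Complex.DeMoivre)
  also have "real m * (2 * pi * real a' / real k) = 2 * pi * real (a' * m) / real k" by simp
  also have "\<dots> = 2 * pi * real y + 2 * pi / real k" unfolding m using k0 by (simp add: field_simps)
  also have "cis \<dots> = cis (2 * pi / real k)" by (simp only: per mult_1_left flip: cis_mult)
  finally show ?thesis using that[of k m] k0 \<open>k \<noteq> 1\<close> by simp
qed

text \<open>
  A full orbit of an extremal point has mean \<open>c\<close>, so no strictly smaller disc contains it.
\<close>
lemma smallest_radius_rotation: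
  fixes u :: complex
  assumes N: "N > 0" "u ^ N = 1" and u: "u \<noteq> 1" "norm u = 1"
    and orbit: "\<And>j. norm (c + u ^ j * w - e) \<le> r"
  shows "norm w \<le> r"
proof (rule ccontr)
  assume "\<not> norm w \<le> r"
  then have r: "r < norm w" by simp
  \<comment> \<open>If the radius were smaller than \<open>norm w\<close>, every point of the orbit
    would be closer to \<open>e\<close> than to \<open>c\<close>, hence have a positive component
    along \<open>e - c\<close>; but the orbit sums to zero around \<open>c\<close>.\<close>
  have pos: "0 < Re (u ^ j * w * cnj (e - c))" for j
  proof -
    have "norm (u ^ j * w - (e - c)) < norm (u ^ j * w)"
      using orbit[of j] r u(2) by (simp add: norm_mult norm_power algebra_simps)
    then have "(norm (u ^ j * w - (e - c)))\<^sup>2 < (norm (u ^ j * w))\<^sup>2"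
      by (rule power_strict_mono) auto
    moreover have "(norm (x - y))\<^sup>2 = (norm x)\<^sup>2 + (norm y)\<^sup>2 - 2 * Re (x * cnj y)" for x y :: complex
      unfolding cmod_power2 by (simp add: power2_eq_square algebra_simps)
    ultimately have "(norm (e - c))\<^sup>2 < 2 * Re (u ^ j * w * cnj (e - c))" by simp
    moreover have "0 \<le> (norm (e - c))\<^sup>2" by simp
    ultimately show ?thesis by linarith
  qed
  have "0 < (\<Sum>j<N. Re (u ^ j * w * cnj (e - c)))" using N(1) by (intro sum_pos pos) auto
  also have "\<dots> = Re ((\<Sum>j<N. u ^ j) * w * cnj (e - c))" by (simp only: Re_sum sum_distrib_right)
  also have "(\<Sum>j<N. u ^ j) = 0" using geometric_sum[OF u(1), of N] N(2) by simp
  finally show False by simp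
qed

lemma card_cx_image:
  assumes "initial_config n C"
  shows "card (cx ` C ` {..<n}) = n"
proof -
  have "inj_on (\<lambda>i. cx (C i)) {..<n}"
    using assms by (auto simp: inj_on_def cx_eq_iff initial_config_def)
  then show ?thesis using card_image by (fastforce simp: image_image)
qed

text \<open>A power of the given rotation has angle \<open>2 * pi / k\<close>. The whole orbit of a
  farthest point from \<open>c\<close> belongs to the configuration, so \<open>c\<close> is the
  centre of a smallest enclosing circle.\<close>

lemma rotation_symmetry_C_odot:
  assumes init: "initial_config n C" "n \<ge> 2"
    and u: "norm u = 1" "u \<noteq> 1"
    and inv: "(\<lambda>z. c + u * (z - c)) ` cx ` C ` {..<n} = cx ` C ` {..<n}"
    and c: "c \<in> cx ` C ` {..<n}"
  shows "C \<in> C_odot n"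
proof -
  define P where "P = cx ` C ` {..<n}"
  have finP: "finite P" "P \<noteq> {}" using c by (auto simp: P_def)
  have injC: "inj_on C {..<n}" using init by (simp add: initial_config_def)
  have "card P = n" unfolding P_def by (rule card_cx_image[OF init(1)])
  then have "\<not> P \<subseteq> {c}" using card_mono[of "{c}" P] init by auto
  then obtain p where p: "p \<in> P" "p \<noteq> c" by blast
  have stepP: "c + u * (z - c) \<in> P" if "z \<in> P" for z
    using inv that unfolding P_def[symmetric] by blast
  obtain N where N: "N > 0" "u ^ N = 1" using finite_order_unit[OF finP(1) p stepP u(1)] .
  have orb: "c + u ^ j * (z - c) \<in> P" if "z \<in> P" for j z
  proof (induction j)
    case (Suc j)
    then show ?case using stepP[OF Suc] by (simp add: mult.assoc)
  qed (use that in simp)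
  obtain k m where k: "k > 1" "u ^ m = cis (2 * pi / real k)" using root_of_unity_generates[OF N u(2)] .
  \<comment> \<open>A point \<open>q\<close> farthest from \<open>c\<close> supplies the
    radius.\<close>
  have "Max ((\<lambda>z. norm (z - c)) ` P) \<in> (\<lambda>z. norm (z - c)) ` P" using finP by (intro Max_in) auto
  then obtain q where "q \<in> P" "Max ((\<lambda>z. norm (z - c)) ` P) = norm (q - c)" by blast
  then have q: "q \<in> P" "\<And>z. z \<in> P \<Longrightarrow> norm (z - c) \<le> norm (q - c)"
    using finP(1) Max_ge[of "(\<lambda>z. norm (z - c)) ` P"] by auto
  have "smallest_enclosing_circle n C (pt c) (norm (q - c))"
    unfolding smallest_enclosing_circle_def
  proof (intro conjI allI impI)
    show "C ` {..<n} \<subseteq> cball (pt c) (norm (q - c))"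
    proof
      fix x assume "x \<in> C ` {..<n}"
      then have "norm (cx x - c) \<le> norm (q - c)" using q(2) by (auto simp: P_def)
      then show "x \<in> cball (pt c) (norm (q - c))"
        using dist_cx[of "pt c" x] by (simp add: dist_norm norm_minus_commute)
    qed
    fix c' r' assume sub: "C ` {..<n} \<subseteq> cball c' r'"
    have "norm (z - cx c') \<le> r'" if "z \<in> P" for z
    proof -
      obtain x where x: "x \<in> C ` {..<n}" "z = cx x" using \<open>z \<in> P\<close> by (auto simp: P_def)
      then have "dist c' x \<le> r'" using sub by auto
      then show ?thesis by (simp add: x dist_cx dist_commute flip: dist_norm)
    qed
    then have "norm (c + u ^ j * (q - c) - cx c') \<le> r'" for j using orb[OF q(1)] by blast
    then show "norm (q - c) \<le> r'" by (rule smallest_radius_rotation[OF N u(2,1)])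
  qed
  moreover have "\<exists>!i. i < n \<and> C i = pt c"
  proof -
    obtain i where i: "i < n" "C i = pt c" using c by auto
    moreover have "j = i" if "j < n" "C j = pt c" for j
      using inj_onD[OF injC, of j i] i that by simp
    ultimately show ?thesis by blast
  qed
  moreover have "image_mset (rotate_about (pt c) (2 * pi / real k)) (points n C) = points n C"
  proof (rule points_invariant[OF init(1)])
    let ?R = "rotate_about (pt c) (2 * pi / real k)"
    have R: "cx (?R x) = c + u ^ m * (cx x - c)" for x by (simp add: cx_rotate_about k(2))
    have "u ^ m \<noteq> 0" using u(1) by auto
    then have "inj ?R" by (auto simp: inj_def R simp flip: cx_eq_iff)
    then show inj: "inj_on ?R (C ` {..<n})" by (rule inj_on_subset) simp
    have "?R x \<in> C ` {..<n}" if "x \<in> C ` {..<n}" for x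
      using orb[of "cx x" m] that unfolding R[symmetric] by (auto simp: P_def cx_eq_iff)
    then show "?R ` C ` {..<n} = C ` {..<n}" by (intro endo_inj_surj inj) auto
  qed
  ultimately show ?thesis unfolding C_odot_def using k(1) by blast
qed

text \<open>The axis passes through \<open>c\<close> in the direction of a square root of
  \<open>u\<close>, by \<open>cx_reflect_in_line\<close>; its robots are the fixed points being
  counted.\<close>

lemma reflection_symmetry_axis:
  assumes init: "initial_config n C"
    and u: "norm u = 1"
    and inv: "(\<lambda>z. c + u * cnj (z - c)) ` cx ` C ` {..<n} = cx ` C ` {..<n}"
    and one: "card {p \<in> cx ` C ` {..<n}. c + u * cnj (p - c) = p} = 1"
  shows "\<exists>L. symmetry_axis n C L \<and> (\<exists>!i. i < n \<and> C i \<in> L)"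
proof -
  define d where "d = pt (csqrt u)"
  have d: "norm d = 1" using u by (simp add: d_def flip: norm_cx)
  define L where "L = range (\<lambda>t. pt c + t *\<^sub>R d)"
  have L: "line L" unfolding L_def by (rule line_range[OF d])
  have R: "cx (reflect_in L q) = c + u * cnj (cx q - c)" for q
    unfolding L_def cx_reflect_in_line[OF d] by (simp add: d_def)
  have "cx ` reflect_in L ` C ` {..<n} = (\<lambda>z. c + u * cnj (z - c)) ` cx ` C ` {..<n}"
    by (simp only: image_image R)
  then have "cx ` reflect_in L ` C ` {..<n} = cx ` C ` {..<n}" by (simp only: inv)
  moreover have "inj cx" by (simp add: inj_def cx_eq_iff)
  ultimately have "reflect_in L ` C ` {..<n} = C ` {..<n}" by (simp only: inj_image_eq_iff)
  then have ax: "symmetry_axis n C L" using L by (simp add: symmetry_axis_def)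
  have inL: "q \<in> L \<longleftrightarrow> c + u * cnj (cx q - c) = cx q" for q
    using reflect_in_fixed_iff[OF L, of q] unfolding cx_eq_iff[symmetric] R by simp
  obtain p where p: "{p \<in> cx ` C ` {..<n}. c + u * cnj (p - c) = p} = {p}"
    using one by (auto simp: card_1_singleton_iff)
  then have "p \<in> cx ` C ` {..<n}" "c + u * cnj (p - c) = p" by blast+
  then obtain i where i: "i < n" "p = cx (C i)" by auto
  have "C i \<in> L" using \<open>c + u * cnj (p - c) = p\<close> i(2) by (simp only: inL)
  moreover have "j = i" if "j < n" "C j \<in> L" for j
  proof -
    have "cx (C j) \<in> {p \<in> cx ` C ` {..<n}. c + u * cnj (p - c) = p}"
      using that inL by blast
    then have "C j = C i" unfolding p using i(2) by (simp add: cx_eq_iff)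
    then show ?thesis using init that(1) i(1) inj_onD[of C "{..<n}" j i] by (simp add: initial_config_def)
  qed
  ultimately show ?thesis using ax i(1) by blast
qed

text \<open>Translates the two excluded geometric situations into the hypothesis of
  \<open>equivariant_derangement\<close>: a rotation with one fixed robot leads to
  \<open>C_odot\<close>, a reflection to an axis with one robot.\<close>

lemma symmetry_fixes_not_one:
  assumes init: "n \<ge> 2" "initial_config n C"
    and g: "g \<in> set_symmetries (cx ` C ` {..<n})" "g \<noteq> id"
    and "C \<notin> C_odot n" "\<not> (\<exists>L. symmetry_axis n C L \<and> (\<exists>!i. i < n \<and> C i \<in> L))"
  shows "card {p \<in> cx ` C ` {..<n}. g p = p} \<noteq> 1"
proof
  let ?P = "cx ` C ` {..<n}"
  assume one: "card {p \<in> ?P. g p = p} = 1"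
  have card: "card ?P = n" by (rule card_cx_image[OF init(2)])
  have inv: "g ` ?P = ?P" using g(1) by (simp add: set_symmetries_def)
  have fin: "finite ?P" by simp
  have "2 \<le> card ?P" using card init by simp
  note cases = set_symmetries_cases[OF g(1) fin this, consumes 0, case_names rotation reflection]
  show False
  proof (cases rule: cases)
    case (rotation u)
    define c where "c = centroid ?P"
    have gc: "g = (\<lambda>z. c + u * (z - c))" using rotation by (simp add: c_def)
    have u: "u \<noteq> 1" using g(2) gc by (auto simp: fun_eq_iff)
    have "{p \<in> ?P. g p = p} \<noteq> {}" using one by force
    then obtain p where p: "p \<in> ?P" "g p = p" by blast
    \<comment> \<open>The fixed point of a nontrivial rotation is its centre, so the centroid is
      occupied.\<close>
    have "(u - 1) * (p - c) = 0" using p(2) unfolding gc by (simp add: algebra_simps)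
    then have "c \<in> ?P" using u p(1) by simp
    then show False
      using rotation_symmetry_C_odot[OF init(2,1) rotation(1) u inv[unfolded gc]] assms(5) by blast
  next
    case (reflection u)
    define c where "c = centroid ?P"
    have gc: "g = (\<lambda>z. c + u * cnj (z - c))" using reflection by (simp add: c_def)
    show False
      using reflection_symmetry_axis[OF init(2) reflection(1) inv[unfolded gc] one[unfolded gc]] assms(6)
      by blast
  qed
qed

text \<open>
  The algorithm matches its snapshot with the target set by any similarity \<open>h\<close>; by equivariance
  of \<open>f\<close> the destination does not depend on the choice.
\<close>
lemma equivariant_map_realizable:
  assumes f: "f ` P = P" "\<And>g p. g \<in> set_symmetries P \<Longrightarrow> p \<in> P \<Longrightarrow> f (g p) = g (f p)"
  shows "\<exists>F. \<forall>n Z C i. cx ` C ` {..<n} = P \<longrightarrow> i < n \<longrightarrow> cartesian (Z i) \<longrightarrow>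
    cx (move n F Z C i) = f (cx (C i))"
proof -
  define F :: algorithm where "F M =
    (let h = SOME h. h \<in> plane_similarities \<and> h ` cx ` set_mset M = P in pt (inv h (f (h 0))))" for M
  have "cx (move n F Z C i) = f (cx (C i))"
    if C: "cx ` C ` {..<n} = P" and i: "i < n" and Z: "cartesian (Z i)" for n Z C i
  proof -
    define p where "p = cx (C i)"
    define l where "l = (\<lambda>w. cx (to_local (Z i) (C i) (pt w)))"
    define M where "M = snapshot n Z C i"
    have l: "l \<in> plane_similarities" unfolding l_def by (rule cx_to_local[OF Z])
    have lp: "l p = 0" by (simp add: l_def p_def to_local_self)
    have pP: "p \<in> P" using C i p_def by blast
    have M: "cx ` set_mset M = l ` P"
      unfolding M_def snapshot_def C[symmetric] by (simp add: set_points image_image l_def)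
    obtain l' where l': "l' \<in> plane_similarities" "l' \<circ> l = id"
      using inverse_plane_similarities[OF l] by metis
    define h where "h = (SOME h. h \<in> plane_similarities \<and> h ` cx ` set_mset M = P)"
    have "l' ` l ` P = P" using l'(2) by (simp add: image_comp)
    then have "\<exists>h. h \<in> plane_similarities \<and> h ` cx ` set_mset M = P" using l'(1) M by auto
    then have h: "h \<in> plane_similarities" "h ` l ` P = P"
      using someI_ex[of "\<lambda>h. h \<in> plane_similarities \<and> h ` cx ` set_mset M = P"] M by (auto simp: h_def)
    obtain h' where h': "h' \<circ> h = id" using inverse_plane_similarities[OF h(1)] by metis
    then have inj: "inj h" by (metis inj_on_id inj_on_imageI2)
    \<comment> \<open>Since \<open>l p = 0\<close>, equivariance under \<open>h \<circ> l\<close>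
      turns \<open>f (h 0)\<close> into \<open>h (l (f p))\<close>. Undoing \<open>h\<close> leaves
      \<open>l (f p)\<close>, the local coordinates of the intended destination.\<close>
    have "h \<circ> l \<in> set_symmetries P"
      unfolding set_symmetries_def using comp_plane_similarities[OF h(1) l] h(2) by (simp add: image_comp)
    from f(2)[OF this pP] have "f (h 0) = h (l (f p))" by (simp add: lp)
    then have "F M = pt (l (f p))" unfolding F_def Let_def h_def[symmetric] by (simp add: inv_f_f[OF inj])
    also have "\<dots> = to_local (Z i) (C i) (pt (f p))" by (simp add: l_def)
    finally show ?thesis by (simp add: move_def M_def[symmetric] to_global_to_local[OF Z] p_def)
  qed
  then show ?thesis by blast
qed

text \<open>Carried over to indices, \<open>f\<close> becomes a fixed-point-free permutation. Each
  round only permutes the occupied positions, so the same algorithm realises \<open>f\<close> again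
  in every later round.\<close>

lemma solvable_if_equivariant_derangement:
  assumes init: "initial_config n C"
    and f: "f ` cx ` C ` {..<n} = cx ` C ` {..<n}" "\<And>p. p \<in> cx ` C ` {..<n} \<Longrightarrow> f p \<noteq> p"
      "\<And>g p. g \<in> set_symmetries (cx ` C ` {..<n}) \<Longrightarrow> p \<in> cx ` C ` {..<n} \<Longrightarrow> f (g p) = g (f p)"
  shows "move_all_1_solvable n C"
proof -
  let ?P = "cx ` C ` {..<n}"
  obtain F where F: "\<And>Z C' i. cx ` C' ` {..<n} = ?P \<Longrightarrow> i < n \<Longrightarrow> cartesian (Z i) \<Longrightarrow>
      cx (move n F Z C' i) = f (cx (C' i))"
    using equivariant_map_realizable[OF f(1,3)] by blast
  define e where "e = cx \<circ> C"
  have eP: "e ` {..<n} = ?P" by (simp add: e_def image_comp)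
  have inje: "inj_on e {..<n}"
    using init by (auto simp: inj_on_def cx_eq_iff initial_config_def e_def)
  have bije: "bij_betw e {..<n} ?P" using inje eP by (simp add: bij_betw_def)
  have bijf: "bij_betw f ?P ?P" using f(1) by (simp add: bij_betw_def eq_card_imp_inj_on)
  define \<pi>' where "\<pi>' = the_inv_into {..<n} e \<circ> (f \<circ> e)"
  \<comment> \<open>\<open>permutes\<close> demands the identity outside
    \<open>{..<n}\<close>.\<close>
  define \<pi> where "\<pi> i = (if i < n then \<pi>' i else i)" for i
  have "bij_betw \<pi>' {..<n} {..<n}"
    unfolding \<pi>'_def
    by (rule bij_betw_trans[OF bij_betw_trans[OF bije bijf] bij_betw_the_inv_into[OF bije]])
  then have "bij_betw \<pi> {..<n} {..<n}" by (rule bij_betw_cong[THEN iffD1, rotated]) (simp add: \<pi>_def)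
  then have perm: "\<pi> permutes {..<n}" by (rule bij_imp_permutes) (simp add: \<pi>_def)
  have e\<pi>: "e (\<pi> i) = f (e i)" if "i < n" for i
  proof -
    have "f (e i) \<in> e ` {..<n}" using that eP f(1) by blast
    then show ?thesis using that f_the_inv_into_f[OF inje] by (simp add: \<pi>_def \<pi>'_def)
  qed
  have "\<pi> i \<noteq> i" if "i < n" for i
  proof
    assume "\<pi> i = i"
    then have "f (e i) = e i" using e\<pi>[OF that] by simp
    then show False using f(2) that eP by blast
  qed
  then have fp: "\<pi> \<in> fixpoint_free_perms n" using perm by (simp add: fixpoint_free_perms_def)
  have "run n F Z C t j = permute_config (\<pi> ^^ t) C j" if Z: "admissible n Z" and j: "j < n" for Z t j
    using j
  proof (induction t arbitrary: j)
    case 0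
    then show ?case by (simp add: run_def permute_config_def)
  next
    case (Suc t)
    have perm_t: "(\<pi> ^^ t) permutes {..<n}" 
    proof (induction t)
      case 0
      show ?case by (simp only: funpow.simps permutes_id)
    next
      case (Suc t)
      then show ?case unfolding funpow.simps by (intro permutes_compose perm)
    qed
    \<comment> \<open>The set of positions after \<open>t\<close> rounds is still the initial one,
      which is what \<open>F\<close> requires.\<close>
    have "cx ` run n F Z C t ` {..<n} = cx ` (\<lambda>j. C ((\<pi> ^^ t) j)) ` {..<n}"
      using Suc.IH by (simp add: permute_config_def)
    also have "\<dots> = cx ` C ` (\<pi> ^^ t) ` {..<n}" by (simp only: image_image)
    finally have im: "cx ` run n F Z C t ` {..<n} = ?P" using permutes_image[OF perm_t] by simp
    have jn: "(\<pi> ^^ t) j < n" using permutes_in_image[OF perm_t, of j] Suc.prems by simp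
    have "cx (run n F Z C (Suc t) j) = cx (move n F Z (run n F Z C t) j)" by (simp add: run_def)
    also have "\<dots> = f (cx (run n F Z C t j))"
      using F[OF im Suc.prems] Z Suc.prems by (simp add: admissible_def)
    also have "\<dots> = f (e ((\<pi> ^^ t) j))" using Suc.IH[OF Suc.prems] by (simp add: permute_config_def e_def)
    also have "\<dots> = e (\<pi> ((\<pi> ^^ t) j))" using e\<pi>[OF jn] by simp
    also have "\<dots> = cx (permute_config (\<pi> ^^ Suc t) C j)" by (simp add: e_def permute_config_def)
    finally show ?case by (rule cx_eq_iff[THEN iffD1])
  qed
  then show ?thesis using fp unfolding move_all_1_solvable_def solves_move_all_1_def by blast
qed

theorem theorem8:
  fixes n :: nat and C0 :: config
  assumes "n \<ge> 2"
    and "initial_config n C0"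
  shows "move_all_1_solvable n C0 \<longleftrightarrow>
    C0 \<notin> C_odot n \<and> \<not> (\<exists>L. symmetry_axis n C0 L \<and> (\<exists>!i. i < n \<and> C0 i \<in> L))"
proof
  assume "move_all_1_solvable n C0"
  then show "C0 \<notin> C_odot n \<and> \<not> (\<exists>L. symmetry_axis n C0 L \<and> (\<exists>!i. i < n \<and> C0 i \<in> L))"
    using C_odot_unsolvable axis_with_one_robot_unsolvable assms(2) by blast
next
  assume *: "C0 \<notin> C_odot n \<and> \<not> (\<exists>L. symmetry_axis n C0 L \<and> (\<exists>!i. i < n \<and> C0 i \<in> L))"
  let ?P = "cx ` C0 ` {..<n}"
  have card: "card ?P \<ge> 2" using assms(1) by (simp only: card_cx_image[OF assms(2)])
  have fin: "finite ?P" by simp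
  have N: "card {p \<in> ?P. g p = p} \<noteq> 1" if "g \<in> set_symmetries ?P" "g \<noteq> id" for g
    using symmetry_fixes_not_one[OF assms that] * by simp
  show "move_all_1_solvable n C0"
    using equivariant_derangement[OF fin card N] solvable_if_equivariant_derangement[OF assms(2)]
    by metis
qed

end
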